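(* Let $K$ be a field, $n\geq 1$, $R=K[x_1,\ldots,x_n]$, let $\Delta$ be a simplicial complex on the vertex set $[n]=\{1,\ldots,n\}$ such that no $v\in[n]$ belongs to every facet of $\Delta$ (that is, $\Delta=\operatorname{core}(\Delta)$), let $I\subseteq R$ be its Stanley--Reisner ideal, and let $J_1\subseteq R$ be the monomial ideal defined in the context. For a pair $(F,G)$ of $\Delta$ set $$A(F,G):=\Big(\prod_{i\in F}x_i^2\Big)\Big(\prod_{i\in[n]\setminus(F\cup G)}x_i\Big),$$ and for a monomial $m\in R$ set $Y(m):=(\operatorname{supp}_2(m),\,[n]\setminus\operatorname{supp}(m))$. Then the set $\{A(F,G): (F,G)\text{ a maximal free pair of }\Delta\}$ is the minimal monomial generating set of $J_1$. Moreover, $A$ and $Y$ define one-to-one correspondences between the set of maximal free pairs of $\Delta$ and the set of minimal monomial generators of $J_1$.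
   Context: A simplicial complex $\Delta$ on $[n]$ is a non-empty collection of subsets of $[n]$ (faces) closed under taking subsets; facets are the inclusion-maximal faces. The Stanley--Reisner ideal $I$ is generated by the squarefree monomials $\mathbf{x}_N=\prod_{i\in N}x_i$ with $N\subseteq[n]$, $N\notin\Delta$. $I^{[2]}$ denotes the ideal generated by the squares of the monomials in $I$. $(I^{[2]}:I)=\{f\in R: fI\subseteq I^{[2]}\}$, which is a monomial ideal. $J_1$ is the ideal generated by all monomials lying in $(I^{[2]}:I)$ but not in $I^{[2]}+(x_1\cdots x_n)$ (equivalently, by those minimal monomial generators of $(I^{[2]}:I)$ that do not lie in $I^{[2]}+(x_1\cdots x_n)$); $J_1=0$ if there are none. For a monomial $m$ and $k\ge 0$, $\operatorname{supp}_k(m)=\{i\in[n]:\deg_{x_i}(m)\geq k\}$ and $\operatorname{supp}(m)=\operatorname{supp}_1(m)$. A pair of $\Delta$ is a pair $(F,G)$ of non-empty subsets of $[n]$ with $F\cap G=\emptyset$ and $F\cup G\in\Delta$. It is a free pair if in addition $F\cup G$ equals the intersection of all facets of $\Delta$ containing $F$. Free pairs are partially ordered by $(F,G)\leq(F',G')$ iff $F\supseteq F'$ and $G\subseteq G'$. A maximal free pair is a maximal element of this poset. *)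

theory Defs
  imports Complex_Main "HOL-Library.Poly_Mapping" "HOL-Library.Set_Algebras"
begin

(* The vertex set [n] is rendered as UNIV of a finite type 'n, so n = CARD('n) >= 1.
   Polynomials in the variables x_i (i :: 'n) over 'k are finitely supported maps from
   exponent vectors to coefficients, with the convolution product of Poly_Mapping. *)

type_synonym ('n, 'k) mpoly = "('n \<Rightarrow>\<^sub>0 nat) \<Rightarrow>\<^sub>0 'k"

(* ideal.span S is the ideal generated by S: a commutative ring as a module over itself. *)

global_interpretation ideal: module "(*) :: 'a::comm_ring_1 \<Rightarrow> 'a \<Rightarrow> 'a"
  by standard (simp_all add: algebra_simps)

definition monomials :: "('n, 'k::field) mpoly set"
  where "monomials = range (\<lambda>t. Poly_Mapping.single t 1)"

definition x_var :: "'n \<Rightarrow> ('n, 'k::field) mpoly"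
  where "x_var i = Poly_Mapping.single (Poly_Mapping.single i 1) 1"

(* The 0 only serves to give the zero polynomial a degree. *)
definition deg_in :: "'n \<Rightarrow> ('n, 'k::field) mpoly \<Rightarrow> nat"
  where "deg_in i p = Max (insert 0 ((\<lambda>t. Poly_Mapping.lookup t i) ` Poly_Mapping.keys p))"

definition supp_ge :: "nat \<Rightarrow> ('n, 'k::field) mpoly \<Rightarrow> 'n set"
  where "supp_ge k m = {i. deg_in i m \<ge> k}"

definition ideal_colon :: "'a::comm_ring_1 set \<Rightarrow> 'a set \<Rightarrow> 'a set"
  where "ideal_colon J I = {f. \<forall>g\<in>I. f * g \<in> J}"

definition squares_ideal :: "('n, 'k::field) mpoly set \<Rightarrow> ('n, 'k) mpoly set"
  where "squares_ideal I = ideal.span {m ^ 2 | m. m \<in> monomials \<inter> I}"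

definition is_minimal_monomial_gens :: "('n, 'k::field) mpoly set \<Rightarrow> ('n, 'k) mpoly set \<Rightarrow> bool"
  where "is_minimal_monomial_gens J S \<longleftrightarrow>
    S \<subseteq> monomials \<and> ideal.span S = J \<and> (\<forall>T. T \<subset> S \<longrightarrow> ideal.span T \<noteq> J)"

(* Meaningful for monomial ideals, which have exactly one such set. *)
definition minimal_monomial_gens :: "('n, 'k::field) mpoly set \<Rightarrow> ('n, 'k) mpoly set"
  where "minimal_monomial_gens J = (THE S. is_minimal_monomial_gens J S)"


(* As in the Stanley-Reisner setting, {i} need not be a face for every i. *)
definition simplicial_complex :: "'n::finite set set \<Rightarrow> bool"
  where "simplicial_complex \<Delta> \<longleftrightarrow> \<Delta> \<noteq> {} \<and> (\<forall>F\<in>\<Delta>. \<forall>G. G \<subseteq> F \<longrightarrow> G \<in> \<Delta>)"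

definition facets :: "'n::finite set set \<Rightarrow> 'n set set"
  where "facets \<Delta> = {F\<in>\<Delta>. \<forall>G\<in>\<Delta>. F \<subseteq> G \<longrightarrow> G = F}"

definition stanley_reisner_ideal :: "'n::finite set set \<Rightarrow> ('n, 'k::field) mpoly set"
  where "stanley_reisner_ideal \<Delta> = ideal.span {(\<Prod>i\<in>N. x_var i) | N. N \<notin> \<Delta>}"

definition J1_ideal :: "'n::finite set set \<Rightarrow> ('n, 'k::field) mpoly set"
  where "J1_ideal \<Delta> =
    (let I = stanley_reisner_ideal \<Delta>; I2 = squares_ideal I in
      ideal.span {m \<in> monomials. m \<in> ideal_colon I2 I \<and>
        m \<notin> I2 + ideal.span {\<Prod>i\<in>UNIV. x_var i}})"

definition is_pair :: "'n::finite set set \<Rightarrow> 'n set \<times> 'n set \<Rightarrow> bool"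
  where "is_pair \<Delta> = (\<lambda>(F, G). F \<noteq> {} \<and> G \<noteq> {} \<and> F \<inter> G = {} \<and> F \<union> G \<in> \<Delta>)"

definition is_free_pair :: "'n::finite set set \<Rightarrow> 'n set \<times> 'n set \<Rightarrow> bool"
  where "is_free_pair \<Delta> = (\<lambda>(F, G). is_pair \<Delta> (F, G) \<and> F \<union> G = \<Inter> {H \<in> facets \<Delta>. F \<subseteq> H})"

definition pair_le :: "'n set \<times> 'n set \<Rightarrow> 'n set \<times> 'n set \<Rightarrow> bool"
  where "pair_le = (\<lambda>(F, G) (F', G'). F' \<subseteq> F \<and> G \<subseteq> G')"

definition maximal_free_pairs :: "'n::finite set set \<Rightarrow> ('n set \<times> 'n set) set"
  where "maximal_free_pairs \<Delta> =
    {p. is_free_pair \<Delta> p \<and> (\<forall>q. is_free_pair \<Delta> q \<and> pair_le p q \<longrightarrow> q = p)}"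

definition A_map :: "'n::finite set \<times> 'n set \<Rightarrow> ('n, 'k::field) mpoly"
  where "A_map = (\<lambda>(F, G). (\<Prod>i\<in>F. x_var i ^ 2) * (\<Prod>i\<in>UNIV - (F \<union> G). x_var i))"

definition Y_map :: "('n::finite, 'k::field) mpoly \<Rightarrow> 'n set \<times> 'n set"
  where "Y_map m = (supp_ge 2 m, UNIV - supp_ge 1 m)"

end

theory Submission
  imports Defs
begin

text \<open>
  Everything is read off exponent vectors. A monomial \<open>m\<close> lies in \<open>I\<close> iff its support is a
  non-face, and in \<open>I\<^sup>[\<^sup>2\<^sup>]\<close> iff \<open>supp\<^sub>2 m\<close> is a non-face. Testing the colon condition against
  the non-faces \<open>H \<union> {v}\<close> with \<open>H\<close> a facet and \<open>v \<notin> H\<close> shows that \<open>m\<close> lies in the colon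
  ideal iff each facet containing \<open>F = supp\<^sub>2 m\<close> contains \<open>G = [n] - supp m\<close>. If \<open>m\<close>
  moreover avoids \<open>I\<^sup>[\<^sup>2\<^sup>] + (x\<^sub>1 \<dots> x\<^sub>n)\<close>, then \<open>F\<close> is a face and \<open>G\<close> is non-empty; \<open>F\<close> is
  non-empty because \<open>\<Delta>\<close> is its own core. Enlarging \<open>G\<close> to \<open>C - F\<close>, with \<open>C\<close> the
  intersection of the facets containing \<open>F\<close>, yields a free pair whose monomial divides \<open>m\<close>.
  Divisibility among the monomials \<open>A(F,G)\<close> is the reverse of the order on free pairs.
\<close>

section \<open>Monomial ideals\<close>

definition mon :: "('n \<Rightarrow>\<^sub>0 nat) \<Rightarrow> ('n, 'k::field) mpoly"
  where "mon t = Poly_Mapping.single t 1"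

text \<open>This is divisibility of monomials, expressed on exponent vectors.\<close>

definition exp_le :: "('n \<Rightarrow>\<^sub>0 nat) \<Rightarrow> ('n \<Rightarrow>\<^sub>0 nat) \<Rightarrow> bool"
  where "exp_le s t \<longleftrightarrow> (\<forall>i. Poly_Mapping.lookup s i \<le> Poly_Mapping.lookup t i)"

definition exp_supp :: "nat \<Rightarrow> ('n \<Rightarrow>\<^sub>0 nat) \<Rightarrow> 'n set"
  where "exp_supp k t = {i. k \<le> Poly_Mapping.lookup t i}"

lemma exp_le_refl [simp]: "exp_le t t"
  by (simp add: exp_le_def)

lemma exp_le_trans: "exp_le r s \<Longrightarrow> exp_le s t \<Longrightarrow> exp_le r t"
  unfolding exp_le_def using le_trans by blast

lemma exp_le_antisym: "exp_le s t \<Longrightarrow> exp_le t s \<Longrightarrow> s = t"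
  by (rule poly_mapping_eqI) (simp add: exp_le_def le_antisym)

lemma exp_le_add: "exp_le s t \<Longrightarrow> exp_le s (u + t)"
  by (simp add: exp_le_def lookup_add trans_le_add2)

lemma exp_le_imp_add_diff: "exp_le s t \<Longrightarrow> (t - s) + s = t"
  by (rule poly_mapping_eqI) (simp add: exp_le_def lookup_add lookup_minus)

lemma keys_mon [simp]: "Poly_Mapping.keys (mon t :: ('n, 'k::field) mpoly) = {t}"
  by (simp add: mon_def)

lemma monomials_eq: "monomials = range mon"
  by (simp add: monomials_def mon_def)

lemma mon_mult: "mon s * mon t = mon (s + t)"
  by (simp add: mon_def mult_single)

lemma mon_power: "mon t ^ 2 = mon (t + t)"
  by (simp add: power2_eq_square mon_mult)

lemma mpoly_eq_sum_single:
  "f = (\<Sum>t\<in>Poly_Mapping.keys f. Poly_Mapping.single t (Poly_Mapping.lookup f t))"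
  by (rule poly_mapping_eqI)
    (auto simp: lookup_sum lookup_single when_def in_keys_iff)

text \<open>Adding a multiple of a generator keeps every term divisible by some generator;
  conversely, a term divisible by a generator is a multiple of it. Ideal membership thus becomes a
  condition on each exponent vector.\<close>

lemma mem_span_mon_iff:
  fixes f :: "('n, 'k::field) mpoly"
  shows "f \<in> ideal.span (mon ` M) \<longleftrightarrow> (\<forall>t\<in>Poly_Mapping.keys f. \<exists>s\<in>M. exp_le s t)"
proof
  let ?Q = "\<lambda>f :: ('n, 'k) mpoly. \<forall>t\<in>Poly_Mapping.keys f. \<exists>s\<in>M. exp_le s t"
  assume "f \<in> ideal.span (mon ` M)"
  then show "?Q f"
  proof (rule ideal.span_induct_alt)
    show "?Q 0" by simp
    fix c x y :: "('n, 'k) mpoly"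
    assume x: "x \<in> mon ` M" and y: "?Q y"
    from x obtain s where s: "s \<in> M" "x = mon s" by blast
    have "\<exists>s\<in>M. exp_le s t" if "t \<in> Poly_Mapping.keys (c * x)" for t
    proof -
      from that keys_mult[of c x] obtain u where "t = u + s"
        by (auto simp: s(2))
      then show ?thesis using s(1) by (auto intro: exp_le_add exp_le_refl)
    qed
    with y show "?Q (c * x + y)"
      using Poly_Mapping.keys_add[of "c * x" y] by blast
  qed
next
  assume Q: "\<forall>t\<in>Poly_Mapping.keys f. \<exists>s\<in>M. exp_le s t"
  have "Poly_Mapping.single t (Poly_Mapping.lookup f t) \<in> ideal.span (mon ` M)"
    if "t \<in> Poly_Mapping.keys f" for t
  proof -
    from Q that obtain s where s: "s \<in> M" "exp_le s t" by blast
    \<comment> \<open>The truncated difference \<open>t - s\<close> is the exact quotient exponent,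
      since \<open>s\<close> divides \<open>t\<close>.\<close>
    have "Poly_Mapping.single t (Poly_Mapping.lookup f t)
        = Poly_Mapping.single (t - s) (Poly_Mapping.lookup f t) * mon s"
      by (simp add: mon_def mult_single exp_le_imp_add_diff[OF s(2)])
    then show ?thesis
      using s(1) by (metis ideal.span_base ideal.span_scale imageI)
  qed
  then show "f \<in> ideal.span (mon ` M)"
    by (subst mpoly_eq_sum_single) (rule ideal.span_sum)
qed

lemma mon_mem_span_iff:
  "(mon t :: ('n, 'k::field) mpoly) \<in> ideal.span (mon ` M) \<longleftrightarrow> (\<exists>s\<in>M. exp_le s t)"
  by (simp add: mem_span_mon_iff)

lemma is_minimal_monomial_gens_antichain_iff:
  fixes S :: "('n, 'k::field) mpoly set"
  assumes antichain: "\<And>s t. s \<in> B \<Longrightarrow> t \<in> B \<Longrightarrow> exp_le s t \<Longrightarrow> s = t"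
  shows "is_minimal_monomial_gens (ideal.span (mon ` B)) S \<longleftrightarrow> S = mon ` B"
proof
  assume S: "is_minimal_monomial_gens (ideal.span (mon ` B)) S"
  then obtain C where C: "S = mon ` C"
    unfolding is_minimal_monomial_gens_def monomials_eq subset_image_iff by blast
  have span: "ideal.span (mon ` C) = (ideal.span (mon ` B) :: ('n, 'k) mpoly set)"
    using S C by (simp add: is_minimal_monomial_gens_def)
  have "B \<subseteq> C"
  proof
    fix b assume b: "b \<in> B"
    then have "(mon b :: ('n, 'k) mpoly) \<in> ideal.span (mon ` C)"
      unfolding span by (simp add: ideal.span_base)
    then obtain c where c: "c \<in> C" "exp_le c b"
      by (auto simp: mon_mem_span_iff)
    then have "(mon c :: ('n, 'k) mpoly) \<in> ideal.span (mon ` B)"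
      unfolding span[symmetric] by (simp add: ideal.span_base)
    then obtain b' where b': "b' \<in> B" "exp_le b' c"
      by (auto simp: mon_mem_span_iff)
    have "b' = b"
      using antichain b b' c exp_le_trans by blast
    then have "c = b" using b' c exp_le_antisym by blast
    with c show "b \<in> C" by simp
  qed
  moreover have "\<not> mon ` B \<subset> S"
    using S by (auto simp: is_minimal_monomial_gens_def)
  ultimately show "S = mon ` B"
    using C by blast
next
  assume S: "S = mon ` B"
  have "ideal.span T \<noteq> ideal.span S" if T: "T \<subset> S" for T
  proof
    assume eq: "ideal.span T = ideal.span S"
    from T obtain C where C: "T = mon ` C" "C \<subseteq> B"
      unfolding S by (metis psubset_imp_subset subset_image_iff)
    with T S obtain b where b: "b \<in> B" "b \<notin> C" by blast
    have "mon b \<in> ideal.span T"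
      unfolding eq S using b by (simp add: ideal.span_base)
    then obtain c where "c \<in> C" "exp_le c b"
      by (auto simp: C(1) mon_mem_span_iff)
    then show False using antichain b C(2) by blast
  qed
  then show "is_minimal_monomial_gens (ideal.span (mon ` B)) S"
    by (auto simp: is_minimal_monomial_gens_def monomials_eq S)
qed

section \<open>Supports and exponent vectors of products of variables\<close>

lemma supp_ge_mon:
  "supp_ge k (mon t :: ('n, 'k::field) mpoly) = exp_supp k t"
  \<comment> \<open>The 0 inserted in \<open>deg_in\<close> does not change the maximum, because
    exponents are natural numbers.\<close>
  by (simp add: supp_ge_def exp_supp_def deg_in_def)

lemma prod_x_var_power:
  fixes N :: "'n set"
  shows "finite N \<Longrightarrow> (\<Prod>i\<in>N. x_var i ^ k)
    = (mon (\<Sum>i\<in>N. Poly_Mapping.single i k) :: ('n, 'k::field) mpoly)"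
proof (induction N rule: finite_induct)
  case empty
  then show ?case by (simp add: mon_def flip: single_one)
next
  case (insert j N)
  have "(x_var j :: ('n, 'k) mpoly) ^ k = mon (Poly_Mapping.single j k)" for k
    by (induction k)
      (simp_all add: mon_def x_var_def mult_single flip: single_one single_add)
  with insert show ?case by (simp add: mon_mult)
qed

lemma lookup_sum_single:
  "finite N \<Longrightarrow>
    Poly_Mapping.lookup (\<Sum>i\<in>N. Poly_Mapping.single i k) j = (if j \<in> N then k else 0)"
  by (simp add: lookup_sum lookup_single when_def)

definition sqfree_exp :: "'n set \<Rightarrow> ('n \<Rightarrow>\<^sub>0 nat)"
  where "sqfree_exp N = (\<Sum>i\<in>N. Poly_Mapping.single i 1)"

lemma lookup_sqfree_exp [simp]:
  "Poly_Mapping.lookup (sqfree_exp (N :: 'n::finite set)) i = (if i \<in> N then 1 else 0)"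
  by (simp add: sqfree_exp_def lookup_sum_single)

lemma prod_x_var: "(\<Prod>i\<in>N. x_var i) = mon (sqfree_exp (N :: 'n::finite set))"
  using prod_x_var_power[of N 1] by (simp add: sqfree_exp_def)

lemma exp_le_sqfree_iff: "exp_le (sqfree_exp (N :: 'n::finite set)) t \<longleftrightarrow> N \<subseteq> exp_supp 1 t"
  by (auto simp: exp_le_def exp_supp_def)

section \<open>Membership in the ideals of a simplicial complex\<close>

lemma ex_facet:
  assumes "F \<in> \<Delta>"
  shows "\<exists>H\<in>facets \<Delta>. F \<subseteq> H"
proof -
  obtain H where "H \<in> \<Delta>" "F \<subseteq> H" "\<And>G. G \<in> \<Delta> \<Longrightarrow> H \<subseteq> G \<Longrightarrow> G = H"
    using finite_has_maximal2[of \<Delta> F] assms by auto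
  then show ?thesis unfolding facets_def by blast
qed

lemma face_subset:
  "simplicial_complex \<Delta> \<Longrightarrow> F \<in> \<Delta> \<Longrightarrow> G \<subseteq> F \<Longrightarrow> G \<in> \<Delta>"
  unfolding simplicial_complex_def by blast

text \<open>Non-faces are closed under supersets, so a support contains a non-face exactly when it
  is one.\<close>

lemma mem_stanley_reisner_iff:
  fixes f :: "('n::finite, 'k::field) mpoly"
  assumes "simplicial_complex \<Delta>"
  shows "f \<in> stanley_reisner_ideal \<Delta> \<longleftrightarrow> (\<forall>t\<in>Poly_Mapping.keys f. exp_supp 1 t \<notin> \<Delta>)"
proof -
  have "{(\<Prod>i\<in>N. x_var i) | N. N \<notin> \<Delta>} = (mon ` sqfree_exp ` (- \<Delta>) :: ('n, 'k) mpoly set)"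
    by (auto simp: prod_x_var)
  then have "f \<in> stanley_reisner_ideal \<Delta>
      \<longleftrightarrow> (\<forall>t\<in>Poly_Mapping.keys f. \<exists>N\<in>- \<Delta>. N \<subseteq> exp_supp 1 t)"
    by (simp add: stanley_reisner_ideal_def mem_span_mon_iff exp_le_sqfree_iff)
  also have "\<dots> \<longleftrightarrow> (\<forall>t\<in>Poly_Mapping.keys f. exp_supp 1 t \<notin> \<Delta>)"
    using face_subset[OF assms] by blast
  finally show ?thesis .
qed

text \<open>The two sets of generators may differ, but they have the same multiples, which is all
  that \<open>mem_span_mon_iff\<close> sees.\<close>

lemma squares_stanley_reisner_eq:
  assumes "simplicial_complex \<Delta>"
  shows "squares_ideal (stanley_reisner_ideal \<Delta> :: ('n::finite, 'k::field) mpoly set)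
    = ideal.span (mon ` {t. exp_supp 2 t \<notin> \<Delta>})"
proof -
  have *: "{m ^ 2 | m. m \<in> monomials \<inter> stanley_reisner_ideal \<Delta>}
      = (mon ` {s + s | s. exp_supp 1 s \<notin> \<Delta>} :: ('n, 'k) mpoly set)"
    by (force simp: monomials_eq mem_stanley_reisner_iff[OF assms] mon_power)
  have up: "(\<exists>s\<in>{s + s | s. exp_supp 1 s \<notin> \<Delta>}. exp_le s t) \<longleftrightarrow>
      (\<exists>s\<in>{t. exp_supp 2 t \<notin> \<Delta>}. exp_le s t)" (is "?L \<longleftrightarrow> ?R") for t :: "'n \<Rightarrow>\<^sub>0 nat"
  proof
    assume ?L
    then obtain s where s: "exp_supp 1 s \<notin> \<Delta>" "exp_le (s + s) t" by blast
    have "exp_supp 2 (s + s) = exp_supp 1 s"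
      by (auto simp: exp_supp_def lookup_add)
    with s show ?R by (metis mem_Collect_eq)
  next
    assume ?R
    then obtain s where s: "exp_supp 2 s \<notin> \<Delta>" "exp_le s t" by blast
    \<comment> \<open>The largest squarefree monomial whose square divides x^s.\<close>
    let ?r = "sqfree_exp (exp_supp 2 s)"
    have "exp_supp 1 ?r = exp_supp 2 s"
      by (auto simp: exp_supp_def)
    moreover have "exp_le (?r + ?r) s"
      by (auto simp: exp_le_def lookup_add exp_supp_def)
    ultimately show ?L using s exp_le_trans by (metis (mono_tags, lifting) mem_Collect_eq)
  qed
  show ?thesis
    unfolding squares_ideal_def * set_eq_iff mem_span_mon_iff up by simp
qed

lemma exp_supp_mono: "exp_le s t \<Longrightarrow> exp_supp k s \<subseteq> exp_supp k t"
  by (auto simp: exp_le_def exp_supp_def intro: le_trans)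

lemma ex_nonface_exp_le_iff:
  assumes "simplicial_complex \<Delta>"
  shows "(\<exists>s\<in>{s. exp_supp k s \<notin> \<Delta>}. exp_le s t) \<longleftrightarrow> exp_supp k t \<notin> \<Delta>"
  using face_subset[OF assms] exp_supp_mono[of _ t k] exp_le_refl[of t] by blast

lemma mem_squares_stanley_reisner_iff:
  fixes f :: "('n::finite, 'k::field) mpoly"
  assumes "simplicial_complex \<Delta>"
  shows "f \<in> squares_ideal (stanley_reisner_ideal \<Delta>)
    \<longleftrightarrow> (\<forall>t\<in>Poly_Mapping.keys f. exp_supp 2 t \<notin> \<Delta>)"
  unfolding squares_stanley_reisner_eq[OF assms] mem_span_mon_iff
    ex_nonface_exp_le_iff[OF assms] ..

lemma mon_mem_colon_iff:
  fixes \<Delta> :: "'n::finite set set"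
  assumes \<Delta>: "simplicial_complex \<Delta>"
  shows "(mon t :: ('n, 'k::field) mpoly)
      \<in> ideal_colon (squares_ideal (stanley_reisner_ideal \<Delta>)) (stanley_reisner_ideal \<Delta>)
    \<longleftrightarrow> (\<forall>H\<in>facets \<Delta>. exp_supp 2 t \<subseteq> H \<longrightarrow> - exp_supp 1 t \<subseteq> H)"
    (is "?L \<longleftrightarrow> ?R")
proof
  assume L: ?L
  show ?R
  proof (intro ballI impI subsetI, rule ccontr)
    fix H v
    assume H: "H \<in> facets \<Delta>" "exp_supp 2 t \<subseteq> H" and v: "v \<in> - exp_supp 1 t" "v \<notin> H"
    \<comment> \<open>Maximality of the facet \<open>H\<close> makes \<open>insert v H\<close> a
      non-face, so this squarefree monomial is a test element of the ideal.\<close>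
    let ?s = "sqfree_exp (insert v H)"
    have "insert v H \<notin> \<Delta>"
      using H(1) v(2) unfolding facets_def by blast
    moreover have "exp_supp 1 ?s = insert v H"
      by (auto simp: exp_supp_def)
    ultimately have "(mon ?s :: ('n, 'k) mpoly) \<in> stanley_reisner_ideal \<Delta>"
      by (simp add: mem_stanley_reisner_iff[OF \<Delta>])
    with L have "(mon (t + ?s) :: ('n, 'k) mpoly) \<in> squares_ideal (stanley_reisner_ideal \<Delta>)"
      by (simp add: ideal_colon_def flip: mon_mult)
    then have "exp_supp 2 (t + ?s) \<notin> \<Delta>"
      by (simp add: mem_squares_stanley_reisner_iff[OF \<Delta>])
    \<comment> \<open>The exponent of \<open>v\<close> is 0 + 1; at any other vertex outside
      \<open>H\<close> it is that of \<open>t\<close>, hence below 2.\<close>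
    moreover have "exp_supp 2 (t + ?s) \<subseteq> H"
      using H(2) v(1) by (auto simp: exp_supp_def lookup_add split: if_splits)
    ultimately show False
      using face_subset[OF \<Delta>] H(1) by (auto simp: facets_def)
  qed
next
  assume R: ?R
  have nonface: "exp_supp 2 (t + s) \<notin> \<Delta>" if s: "exp_supp 1 s \<notin> \<Delta>" for s
  proof
    assume "exp_supp 2 (t + s) \<in> \<Delta>"
    then obtain H where H: "H \<in> facets \<Delta>" "exp_supp 2 (t + s) \<subseteq> H"
      using ex_facet by blast
    have "exp_supp 2 t \<subseteq> H"
      using H(2) by (auto simp: exp_supp_def lookup_add)
    with R H(1) have G: "- exp_supp 1 t \<subseteq> H" by blast
    have "exp_supp 1 s \<subseteq> H"
    proof
      fix i assume i: "i \<in> exp_supp 1 s"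
      show "i \<in> H"
      \<comment> \<open>Either x_i divides both factors and its square divides the product, or
        \<open>i\<close> is missing from the support of \<open>t\<close> and \<open>G\<close>
        applies.\<close>
      proof (cases "i \<in> exp_supp 1 t")
        case True
        with i have "i \<in> exp_supp 2 (t + s)" by (simp add: exp_supp_def lookup_add)
        with H(2) show ?thesis by blast
      qed (use G in blast)
    qed
    then show False
      using s face_subset[OF \<Delta>] H(1) by (auto simp: facets_def)
  qed
  show ?L
    unfolding ideal_colon_def mem_Collect_eq
  proof
    fix g :: "('n, 'k) mpoly"
    assume "g \<in> stanley_reisner_ideal \<Delta>"
    then have "\<forall>s\<in>Poly_Mapping.keys g. exp_supp 1 s \<notin> \<Delta>"
      by (simp add: mem_stanley_reisner_iff[OF \<Delta>])
    then show "mon t * g \<in> squares_ideal (stanley_reisner_ideal \<Delta>)"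
      unfolding mem_squares_stanley_reisner_iff[OF \<Delta>]
      using keys_mult[of "mon t" g] nonface by auto
  qed
qed

text \<open>A sum of monomial ideals is generated by the union of the generators, and a multiple of
  the product of all variables is a monomial of full support.\<close>

lemma mon_mem_squares_plus_iff:
  fixes \<Delta> :: "'n::finite set set"
  assumes \<Delta>: "simplicial_complex \<Delta>"
  shows "(mon t :: ('n, 'k::field) mpoly)
      \<in> squares_ideal (stanley_reisner_ideal \<Delta>) + ideal.span {\<Prod>i\<in>UNIV. x_var i}
    \<longleftrightarrow> exp_supp 2 t \<notin> \<Delta> \<or> exp_supp 1 t = UNIV"
proof -
  have "squares_ideal (stanley_reisner_ideal \<Delta>) + ideal.span {\<Prod>i\<in>UNIV. x_var i}
      = (ideal.span (mon ` ({t. exp_supp 2 t \<notin> \<Delta>} \<union> {sqfree_exp UNIV})) :: ('n, 'k) mpoly set)"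
    unfolding image_Un ideal.span_Un squares_stanley_reisner_eq[OF \<Delta>]
    by (auto simp: prod_x_var set_plus_def)
  then show ?thesis
    by (simp only: mon_mem_span_iff bex_Un ex_nonface_exp_le_iff[OF \<Delta>] bex_simps
        exp_le_sqfree_iff top.extremum_unique simp_thms)
qed

text \<open>These are the exponents of the monomials that generate J_1 by definition, with both
  ideal conditions translated into conditions on supports.\<close>

definition J1_exps :: "'n::finite set set \<Rightarrow> ('n \<Rightarrow>\<^sub>0 nat) set"
  where "J1_exps \<Delta> = {t. exp_supp 2 t \<in> \<Delta> \<and> exp_supp 1 t \<noteq> UNIV \<and>
    (\<forall>H\<in>facets \<Delta>. exp_supp 2 t \<subseteq> H \<longrightarrow> - exp_supp 1 t \<subseteq> H)}"

lemma J1_ideal_eq: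
  assumes "simplicial_complex \<Delta>"
  shows "(J1_ideal \<Delta> :: ('n::finite, 'k::field) mpoly set) = ideal.span (mon ` J1_exps \<Delta>)"
  unfolding J1_ideal_def Let_def
  by (rule arg_cong[where f = ideal.span])
    (auto simp: monomials_eq J1_exps_def mon_mem_colon_iff[OF assms]
      mon_mem_squares_plus_iff[OF assms])

section \<open>Maximal free pairs\<close>

definition A_exp :: "'n::finite set \<times> 'n set \<Rightarrow> ('n \<Rightarrow>\<^sub>0 nat)"
  where "A_exp p = (\<Sum>i\<in>fst p. Poly_Mapping.single i 2) + sqfree_exp (UNIV - (fst p \<union> snd p))"

lemma A_map_eq: "A_map p = mon (A_exp p)"
  by (cases p) (simp add: A_map_def A_exp_def mon_mult prod_x_var prod_x_var_power)

lemma lookup_A_exp: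
  "Poly_Mapping.lookup (A_exp (F, G)) i = (if i \<in> F then 2 else if i \<in> G then 0 else 1)"
  by (simp add: A_exp_def lookup_add lookup_sum_single)

lemma
  shows exp_supp_2_A_exp: "exp_supp 2 (A_exp (F, G)) = F"
    and exp_supp_1_A_exp: "F \<inter> G = {} \<Longrightarrow> exp_supp 1 (A_exp (F, G)) = - G"
  by (auto simp: exp_supp_def lookup_A_exp)

lemma free_pair_disjoint: "is_free_pair \<Delta> (F, G) \<Longrightarrow> F \<inter> G = {}"
  by (simp add: is_free_pair_def is_pair_def)

text \<open>A(F,G) has exponent 2 on \<open>F\<close>, 0 on \<open>G\<close> and 1
  elsewhere.\<close>

lemma exp_le_A_exp_iff:
  "F \<inter> G = {} \<Longrightarrow> exp_le (A_exp (F, G)) t \<longleftrightarrow> F \<subseteq> exp_supp 2 t \<and> - exp_supp 1 t \<subseteq> G"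
  unfolding exp_le_def lookup_A_exp exp_supp_def by (auto simp: not_le split: if_splits)

lemma Y_A_free_pair:
  "is_free_pair \<Delta> p \<Longrightarrow> Y_map (A_map p :: ('n::finite, 'k::field) mpoly) = p"
  by (cases p)
    (auto simp: A_map_eq Y_map_def supp_ge_mon exp_supp_2_A_exp
      exp_supp_1_A_exp[OF free_pair_disjoint] simp del: One_nat_def)

text \<open>Divisibility reverses the order of free pairs, so maximal pairs correspond to monomials
  that are minimal under divisibility.\<close>

lemma exp_le_A_exp_pair_iff:
  assumes "is_free_pair \<Delta> p" "is_free_pair \<Delta> q"
  shows "exp_le (A_exp p) (A_exp q) \<longleftrightarrow> pair_le q p"
  using assms
  by (cases p; cases q)
    (simp add: exp_le_A_exp_iff free_pair_disjoint pair_le_def exp_supp_2_A_exp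
      exp_supp_1_A_exp del: One_nat_def)

text \<open>\<open>F\<close> is a face as a subset of one, a non-empty \<open>G\<close> prevents
  full support, and freeness puts \<open>G\<close> into every facet containing
  \<open>F\<close>.\<close>

lemma A_exp_in_J1_exps:
  assumes "simplicial_complex \<Delta>" "is_free_pair \<Delta> p"
  shows "A_exp p \<in> J1_exps \<Delta>"
proof -
  obtain F G where p: "p = (F, G)" by fastforce
  have "F \<union> G \<in> \<Delta>" "G \<noteq> {}" "F \<inter> G = {}" and C: "F \<union> G = \<Inter> {H \<in> facets \<Delta>. F \<subseteq> H}"
    using assms(2) unfolding p is_free_pair_def is_pair_def by blast+
  moreover from this(1) have "F \<in> \<Delta>"
    using face_subset[OF assms(1)] by blast
  moreover have "G \<subseteq> H" if "H \<in> facets \<Delta>" "F \<subseteq> H" for H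
    using that C by blast
  ultimately show ?thesis
    by (auto simp: p J1_exps_def exp_supp_2_A_exp exp_supp_1_A_exp simp del: One_nat_def)
qed

lemma ex_maximal_free_pair_ge:
  fixes \<Delta> :: "'n::finite set set"
  assumes "is_free_pair \<Delta> p"
  shows "\<exists>q\<in>maximal_free_pairs \<Delta>. pair_le p q"
proof -
  let ?X = "{q. is_free_pair \<Delta> q \<and> pair_le p q}"
  \<comment> \<open>Going up in the order shrinks the first set and enlarges the second, so neither
    summand decreases; a pair above \<open>p\<close> that maximises the sum is maximal.\<close>
  let ?f = "\<lambda>q :: 'n set \<times> 'n set. card (- fst q) + card (snd q)"
  have "p \<in> ?X"
    using assms by (simp add: pair_le_def split: prod.split)
  then have "Max (?f ` ?X) \<in> ?f ` ?X"
    by (intro Max_in) (simp, blast)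
  then obtain q where q: "q \<in> ?X" "?f q = Max (?f ` ?X)"
    by (auto simp del: Compl_iff)
  have "r = q" if r: "is_free_pair \<Delta> r" "pair_le q r" for r
  proof -
    have sub: "- fst q \<subseteq> - fst r" "snd q \<subseteq> snd r"
      using r(2) by (auto simp: pair_le_def split: prod.splits)
    have "r \<in> ?X"
      using q(1) r by (auto simp: pair_le_def split: prod.splits)
    then have "?f r \<le> ?f q"
      unfolding q(2) by (intro Max_ge) auto
    moreover have "card (- fst q) \<le> card (- fst r)" "card (snd q) \<le> card (snd r)"
      using sub by (simp_all add: card_mono)
    ultimately have "card (- fst q) = card (- fst r)" "card (snd q) = card (snd r)"
      by linarith+
    then have "- fst q = - fst r" "snd q = snd r"
      using sub card_subset_eq[of "- fst r" "- fst q"] card_subset_eq[of "snd r" "snd q"]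
      by auto
    then show "r = q"
      by (simp add: prod_eq_iff)
  qed
  then show ?thesis
    using q(1) unfolding maximal_free_pairs_def by blast
qed

lemma ex_maximal_free_pair_dividing:
  fixes \<Delta> :: "'n::finite set set"
  assumes \<Delta>: "simplicial_complex \<Delta>"
    and core: "\<not> (\<exists>v. \<forall>F\<in>facets \<Delta>. v \<in> F)"
    and t: "t \<in> J1_exps \<Delta>"
  shows "\<exists>p\<in>maximal_free_pairs \<Delta>. exp_le (A_exp p) t"
proof -
  define F where "F = exp_supp 2 t"
  define C where "C = \<Inter> {H \<in> facets \<Delta>. F \<subseteq> H}"
  have F: "F \<in> \<Delta>" and G: "- exp_supp 1 t \<noteq> {}" "- exp_supp 1 t \<subseteq> C"
    using t by (auto simp: J1_exps_def F_def C_def)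
  have FC: "F \<subseteq> C" by (auto simp: C_def)
  have disj: "F \<inter> - exp_supp 1 t = {}" by (auto simp: F_def exp_supp_def)
  \<comment> \<open>Otherwise \<open>C\<close> would be the intersection of all facets, which
    \<open>core\<close> makes empty, yet \<open>C\<close> contains the non-empty set
    \<open>- exp_supp 1 t\<close>.\<close>
  have "F \<noteq> {}"
  proof
    assume "F = {}"
    then have "C = \<Inter> (facets \<Delta>)" by (simp add: C_def)
    then show False using G core by blast
  qed
  moreover obtain H where "H \<in> facets \<Delta>" "F \<subseteq> H"
    using ex_facet[OF F] by blast
  then have "C \<in> \<Delta>"
    using face_subset[OF \<Delta>, of H C] by (auto simp: C_def facets_def)
  moreover have "F \<union> (C - F) = C" "C - F \<noteq> {}"
    using FC G disj by blast+
  ultimately have free: "is_free_pair \<Delta> (F, C - F)"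
    by (auto simp: is_free_pair_def is_pair_def C_def[symmetric])
  then obtain q where q: "q \<in> maximal_free_pairs \<Delta>" "pair_le (F, C - F) q"
    using ex_maximal_free_pair_ge by blast
  have "exp_le (A_exp q) (A_exp (F, C - F))"
    using q exp_le_A_exp_pair_iff[OF _ free] by (simp add: maximal_free_pairs_def)
  \<comment> \<open>The vertices missing from the support of \<open>t\<close> lie in
    \<open>C - F\<close>, so every variable outside \<open>C\<close> divides x^t.\<close>
  moreover have "exp_le (A_exp (F, C - F)) t"
    using G disj by (subst exp_le_A_exp_iff) (auto simp: F_def)
  ultimately show ?thesis
    using q(1) exp_le_trans by blast
qed

section \<open>The generators of J_1 and the two bijections\<close>

lemma J1_ideal_eq_span_A:
  assumes "simplicial_complex \<Delta>" "\<not> (\<exists>v. \<forall>F\<in>facets \<Delta>. v \<in> F)"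
  shows "(J1_ideal \<Delta> :: ('n::finite, 'k::field) mpoly set)
    = ideal.span (mon ` A_exp ` maximal_free_pairs \<Delta>)"
proof -
  \<comment> \<open>It suffices that both sets of exponents have the same multiples.\<close>
  have "(\<exists>s\<in>J1_exps \<Delta>. exp_le s t) \<longleftrightarrow> (\<exists>s\<in>A_exp ` maximal_free_pairs \<Delta>. exp_le s t)"
    (is "?L \<longleftrightarrow> ?R") for t
  proof
    assume ?L
    then obtain s where "s \<in> J1_exps \<Delta>" "exp_le s t" by blast
    then show ?R
      using ex_maximal_free_pair_dividing[OF assms, of s] exp_le_trans[of _ s t] by blast
  next
    assume ?R
    moreover have "A_exp ` maximal_free_pairs \<Delta> \<subseteq> J1_exps \<Delta>"
      using A_exp_in_J1_exps[OF assms(1)] unfolding maximal_free_pairs_def by blast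
    ultimately show ?L by blast
  qed
  then show ?thesis
    unfolding J1_ideal_eq[OF assms(1)] set_eq_iff mem_span_mon_iff by simp
qed

theorem theorem2p15:
  fixes \<Delta> :: "'n::finite set set"
    and J\<^sub>1 :: "('n, 'k::field) mpoly set"
  assumes "simplicial_complex \<Delta>"
    and core: "\<not> (\<exists>v. \<forall>F\<in>facets \<Delta>. v \<in> F)"
  defines "J\<^sub>1 \<equiv> J1_ideal \<Delta>"
  shows "(\<forall>S. is_minimal_monomial_gens J\<^sub>1 S \<longleftrightarrow> S = A_map ` maximal_free_pairs \<Delta>)
    \<and> bij_betw A_map (maximal_free_pairs \<Delta>) (minimal_monomial_gens J\<^sub>1)
    \<and> bij_betw Y_map (minimal_monomial_gens J\<^sub>1) (maximal_free_pairs \<Delta>)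
    \<and> (\<forall>p\<in>maximal_free_pairs \<Delta>. Y_map (A_map p :: ('n, 'k) mpoly) = p)
    \<and> (\<forall>m\<in>minimal_monomial_gens J\<^sub>1. A_map (Y_map m) = m)"
proof -
  let ?P = "maximal_free_pairs \<Delta>"
  let ?A = "A_map :: _ \<Rightarrow> ('n, 'k) mpoly"
  have image: "?A ` ?P = mon ` A_exp ` ?P"
    by (simp add: image_image A_map_eq)
  have antichain: "s = t" if "s \<in> A_exp ` ?P" "t \<in> A_exp ` ?P" "exp_le s t" for s t
  proof -
    obtain p q where "p \<in> ?P" "q \<in> ?P" "s = A_exp p" "t = A_exp q"
      using \<open>s \<in> _\<close> \<open>t \<in> _\<close> by blast
    moreover from this have "pair_le q p"
      using \<open>exp_le s t\<close> exp_le_A_exp_pair_iff[of \<Delta> p q] by (simp add: maximal_free_pairs_def)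
    \<comment> \<open>Maximality of \<open>q\<close> turns \<open>pair_le q p\<close> into
      equality.\<close>
    ultimately show ?thesis
      unfolding maximal_free_pairs_def by blast
  qed
  have gens: "is_minimal_monomial_gens J\<^sub>1 S \<longleftrightarrow> S = ?A ` ?P" for S
    unfolding J\<^sub>1_def J1_ideal_eq_span_A[OF assms(1) core] image
    using antichain by (rule is_minimal_monomial_gens_antichain_iff)
  \<comment> \<open>By \<open>gens\<close> exactly one set qualifies, so the definite description
    denotes it.\<close>
  then have min: "minimal_monomial_gens J\<^sub>1 = ?A ` ?P"
    by (simp add: minimal_monomial_gens_def)
  have YA: "Y_map (?A p) = p" if "p \<in> ?P" for p
    using that Y_A_free_pair[of \<Delta> p] by (simp add: maximal_free_pairs_def)
  \<comment> \<open>A left inverse on the maximal pairs makes both maps bijections between those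
    pairs and their image.\<close>
  then have "bij_betw A_map ?P (?A ` ?P)" "bij_betw Y_map (?A ` ?P) ?P"
    by (auto intro!: bij_betw_byWitness[where f' = Y_map] bij_betw_byWitness[where f' = A_map])
  with gens min YA show ?thesis
    by auto
qed

end
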